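(* For every finite alphabet $\Lambda$ and every $\varepsilon>0$ there is $\delta>0$ such that if $\mathbf{X}=(X_i)_{i=0}^\infty$ and $\mathbf{X}'=(X'_i)_{i=0}^\infty$ are ergodic $\Lambda$-valued stationary processes with $\bar f_{\mathcal{M}}(\mathbf{X},\mathbf{X}')<\delta$, then $|\bar H(\mathbf{X})-\bar H(\mathbf{X}')|<\varepsilon$.
   Context: A stationary process is ergodic if its distribution, a shift-invariant probability measure on $\Lambda^{\mathbb{N}_0}$, is ergodic for the left shift. Entropy rate: for a stationary $\Lambda$-valued process $\mathbf{Z}=(Z_i)_{i=0}^\infty$ with law $\nu$, $$\bar H(\mathbf{Z})=\lim_{n\to\infty}\frac1n\sum_{\lambda_1\ldots\lambda_n\in\Lambda^n}\eta\big(\nu(Z_0=\lambda_1,\ldots,Z_{n-1}=\lambda_n)\big),$$ where $\eta(0)=0$ and $\eta(t)=-t\log t$ for $t>0$ (the base of the logarithm is fixed). The limit exists. For $n\in\mathbb{N}$ and words $u=u_0\ldots u_{n-1}$, $w=w_0\ldots w_{n-1}$ in $\Lambda^n$ let $\bar f_n(u,w)=\frac{n-k}{n}$, where $k$ is the largest integer such that for some $0\le i(1)<\cdots<i(k)<n$ and $0\le j(1)<\cdots<j(k)<n$ one has $u_{i(s)}=w_{j(s)}$ for $s=1,\ldots,k$. The Feldman–Katok metric $\bar f_{\mathcal{M}}$ between processes: for stationary $\Lambda$-valued processes $\mathbf{X},\mathbf{X}'$ let $\mu_n$ and $\mu'_n$ be the distributions on $\Lambda^n$ of $(X_0,\ldots,X_{n-1})$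 and $(X'_0,\ldots,X'_{n-1})$. Then $$\bar f_{\mathcal{M}}(\mathbf{X},\mathbf{X}')=\limsup_{n\to\infty}\ \inf_{\pi}\ \sum_{(u,w)\in\Lambda^n\times\Lambda^n}\bar f_n(u,w)\,\pi(u,w),$$ where the infimum is over all probability measures $\pi$ on $\Lambda^n\times\Lambda^n$ with marginals $\mu_n$ and $\mu'_n$. *)

theory Defs
  imports "HOL-Probability.Probability"
begin

text \<open>
  The alphabet is a finite type \<open>'a\<close>. Stationarity, ergodicity, entropy rate and the
  Feldman--Katok distance of a process depend only on its law on \<open>'a\<^sup>\<nat>\<close>, so a
  process is represented by that law, equivalently by the coordinate process
  \<open>X i z = z i\<close> on the sequence space. (Quantifying over laws also keeps the
  sample-space types out of the statement, so that a constant chosen before the processes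
  cannot depend on them.) A process given as random variables on an arbitrary
  probability space enters through \<open>process_law\<close>.
\<close>

definition seq_space :: "(nat \<Rightarrow> 'a::finite) measure" where
  "seq_space = PiM UNIV (\<lambda>_. count_space UNIV)"

definition process_law :: "'w measure \<Rightarrow> (nat \<Rightarrow> 'w \<Rightarrow> 'a::finite) \<Rightarrow> (nat \<Rightarrow> 'a) measure" where
  "process_law M X = distr M seq_space (\<lambda>\<omega> i. X i \<omega>)"

definition shift :: "(nat \<Rightarrow> 'a) \<Rightarrow> nat \<Rightarrow> 'a" where
  "shift z = (\<lambda>i. z (Suc i))"

definition stationary :: "(nat \<Rightarrow> 'a::finite) measure \<Rightarrow> bool" where
  "stationary \<nu> \<longleftrightarrow>
     prob_space \<nu> \<and> sets \<nu> = sets seq_space \<and> distr \<nu> seq_space shift = \<nu>"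

definition ergodic :: "(nat \<Rightarrow> 'a::finite) measure \<Rightarrow> bool" where
  "ergodic \<nu> \<longleftrightarrow>
     stationary \<nu> \<and> (\<forall>A\<in>sets \<nu>. shift -` A = A \<longrightarrow> measure \<nu> A = 0 \<or> measure \<nu> A = 1)"

definition words :: "nat \<Rightarrow> 'a list set" where
  "words n = {u. length u = n}"

text \<open>The distribution of \<open>(X\<^sub>0, \<dots>, X\<^sub>n\<^sub>-\<^sub>1)\<close>, as a measure on all
  lists that is concentrated on \<open>words n\<close>.\<close>

definition block_dist :: "(nat \<Rightarrow> 'a::finite) measure \<Rightarrow> nat \<Rightarrow> 'a list measure" where
  "block_dist \<nu> n = distr \<nu> (count_space UNIV) (\<lambda>z. map z [0..<n])"

definition \<eta> :: "real \<Rightarrow> real \<Rightarrow> real" where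
  "\<eta> b t = (if t > 0 then - t * log b t else 0)"

text \<open>Here \<open>b\<close> is the base of the logarithm. For stationary \<open>\<nu>\<close> the limit exists.\<close>

definition entropy_rate :: "real \<Rightarrow> (nat \<Rightarrow> 'a::finite) measure \<Rightarrow> real" where
  "entropy_rate b \<nu> = lim (\<lambda>n. (1 / real n) * (\<Sum>u\<in>words n. \<eta> b (measure (block_dist \<nu> n) {u})))"

definition matching :: "nat \<Rightarrow> 'a list \<Rightarrow> 'a list \<Rightarrow> nat \<Rightarrow> bool" where
  "matching n u w k \<longleftrightarrow>
     (\<exists>i j :: nat \<Rightarrow> nat.
        strict_mono_on {1..k} i \<and> strict_mono_on {1..k} j \<and>
        (\<forall>s\<in>{1..k}. i s < n \<and> j s < n \<and> u ! i s = w ! j s))"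

definition fbar :: "nat \<Rightarrow> 'a list \<Rightarrow> 'a list \<Rightarrow> real" where
  "fbar n u w = (real n - real (GREATEST k. matching n u w k)) / real n"

text \<open>The marginal conditions force a coupling to be supported on
  \<open>words n \<times> words n\<close>.\<close>

definition couplings ::
  "(nat \<Rightarrow> 'a::finite) measure \<Rightarrow> (nat \<Rightarrow> 'a) measure \<Rightarrow> nat \<Rightarrow> ('a list \<times> 'a list) pmf set" where
  "couplings \<nu> \<nu>' n =
     {\<pi>. measure_pmf (map_pmf fst \<pi>) = block_dist \<nu> n \<and>
         measure_pmf (map_pmf snd \<pi>) = block_dist \<nu>' n}"

definition FK_dist :: "(nat \<Rightarrow> 'a::finite) measure \<Rightarrow> (nat \<Rightarrow> 'a) measure \<Rightarrow> ereal" where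
  "FK_dist \<nu> \<nu>' =
     limsup (\<lambda>n. ereal (INF \<pi>\<in>couplings \<nu> \<nu>' n.
       \<Sum>(u, w)\<in>words n \<times> words n. fbar n u w * pmf \<pi> (u, w)))"

lemma space_seq_space [simp]: "space (seq_space :: (nat \<Rightarrow> 'a::finite) measure) = UNIV"
  by (simp add: seq_space_def space_PiM)

lemma measurable_block:
  "(\<lambda>z. map z [0..<n]) \<in> measurable (seq_space :: (nat \<Rightarrow> 'a::finite) measure) (count_space UNIV)"
proof (induction n)
  case (Suc n)
  note [measurable] = Suc
  have [measurable]: "(\<lambda>z. z n) \<in> measurable (seq_space :: (nat \<Rightarrow> 'a) measure) (count_space UNIV)"
    unfolding seq_space_def by (rule measurable_component_singleton) simp
  show ?case by simp
qed simp

lemma block_dist_process_law: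
  fixes X :: "nat \<Rightarrow> 'w \<Rightarrow> 'a::finite"
  assumes "\<And>i. X i \<in> measurable M (count_space UNIV)"
  shows "block_dist (process_law M X) n = distr M (count_space UNIV) (\<lambda>\<omega>. map (\<lambda>i. X i \<omega>) [0..<n])"
proof -
  have "(\<lambda>\<omega> i. X i \<omega>) \<in> measurable M seq_space"
    unfolding seq_space_def using assms by (intro measurable_PiM_single') auto
  then show ?thesis
    unfolding block_dist_def process_law_def
    by (simp add: distr_distr measurable_block comp_def)
qed

lemma process_law_coordinates:
  "stationary \<nu> \<Longrightarrow> process_law \<nu> (\<lambda>i z. z i) = \<nu>"
  unfolding process_law_def stationary_def by (simp add: distr_id2)

end

theory Submission
  imports Defs
begin

text \<open>
  Entropy is Lipschitz, up to a correction that is linear in the word length, with respect to the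
  cost of a coupling. Let \<open>\<pi>\<close> couple the \<open>n\<close>-block distributions \<open>\<mu>\<close> and \<open>\<mu>'\<close>. Comparing \<open>\<pi>\<close>
  with the sub-probability \<open>\<mu>' w * K u w\<close>, where \<open>K \<sqdot> w\<close> has total mass at most \<open>1\<close> for every
  \<open>w\<close>, Gibbs' inequality gives
  \<open>H \<mu> \<le> H \<pi> \<le> H \<mu>' + E\<^sub>\<pi> (- log (K u w))\<close> (lemma \<open>entropy_fst_le_snd_plus_cost\<close>).

  The kernel to use decays geometrically in the number \<open>d u w = n * fbar n u w\<close> of unmatched
  letters: \<open>K u w = \<theta> ^ d u w / (1 + s) ^ (2 * n)\<close> with \<open>\<theta> = s\<^sup>2 / N\<close> for an alphabet of \<open>N\<close>
  letters. It is sub-stochastic because a word \<open>u\<close> is recovered from \<open>w\<close>, the matched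
  positions in \<open>u\<close> and in \<open>w\<close>, and the \<open>d u w\<close> unmatched letters of \<open>u\<close>
  (lemma \<open>sum_unmatched_le\<close>). Hence
  \<open>H \<mu> / n \<le> H \<mu>' / n + 2 * log (1 + s) + E\<^sub>\<pi> (fbar n u w) * log (1 / \<theta>)\<close>.
  Choosing first \<open>s\<close> with \<open>2 * log (1 + s) = \<epsilon> / 3\<close>, and then \<open>\<delta>\<close> small in terms of \<open>\<theta>\<close>, bounds
  the right-hand side by \<open>H \<mu>' / n + 2 * \<epsilon> / 3\<close> for a coupling of expected cost below \<open>\<delta>\<close>.
  By symmetry the two normalised block entropies differ by at most \<open>2 * \<epsilon> / 3\<close> for all large \<open>n\<close>.
  This passes to the entropy rates because the limits that define them exist, by subadditivity
  of block entropy under stationarity and Fekete's lemma.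
\<close>

section \<open>Entropy of finitely supported distributions\<close>

definition pmf_entropy :: "real \<Rightarrow> 'c pmf \<Rightarrow> real" where
  "pmf_entropy b p = measure_pmf.expectation p (\<lambda>x. - log b (pmf p x))"

lemma pmf_entropy_eq_sum:
  assumes "finite A" "set_pmf p \<subseteq> A"
  shows "pmf_entropy b p = (\<Sum>x\<in>A. \<eta> b (pmf p x))"
proof -
  have "pmf_entropy b p = (\<Sum>x\<in>A. - log b (pmf p x) * pmf p x)"
    unfolding pmf_entropy_def using assms by (intro integral_measure_pmf_real) auto
  also have "\<dots> = (\<Sum>x\<in>A. \<eta> b (pmf p x))"
    by (intro sum.cong refl) (simp add: \<eta>_def order_less_le[of 0])
  finally show ?thesis .
qed

lemma pmf_entropy_nonneg:
  assumes "b > 1"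
  shows "pmf_entropy b p \<ge> 0"
  unfolding pmf_entropy_def
proof (intro integral_nonneg_AE, unfold AE_measure_pmf_iff, intro ballI)
  fix x assume "x \<in> set_pmf p"
  then have "log b (pmf p x) \<le> log b 1"
    using assms by (intro log_mono pmf_positive pmf_le_1)
  then show "- log b (pmf p x) \<ge> 0" by simp
qed

text \<open>Gibbs' inequality, which is \<open>ln t \<le> t - 1\<close> averaged at \<open>t = q x / p x\<close>.\<close>

lemma pmf_entropy_le_cross_entropy:
  assumes b: "b > 1" and fin: "finite (set_pmf p)"
    and pos: "\<And>x. x \<in> set_pmf p \<Longrightarrow> q x > 0"
    and sub: "(\<Sum>x\<in>set_pmf p. q x) \<le> 1"
  shows "pmf_entropy b p \<le> measure_pmf.expectation p (\<lambda>x. - log b (q x))"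
proof -
  let ?S = "set_pmf p"
  have "- log b (pmf p x) * pmf p x - - log b (q x) * pmf p x \<le> (q x - pmf p x) / ln b"
    if x: "x \<in> ?S" for x
  proof -
    have p: "pmf p x > 0" using x by (rule pmf_positive)
    have "ln (q x) - ln (pmf p x) \<le> q x / pmf p x - 1"
      using ln_le_minus_one[of "q x / pmf p x"] pos[OF x] p by (simp add: ln_div)
    then have "(ln (q x) - ln (pmf p x)) * pmf p x \<le> (q x / pmf p x - 1) * pmf p x"
      using p by (intro mult_right_mono) auto
    also have "\<dots> = q x - pmf p x" using p by (simp add: field_simps)
    finally have "(ln (q x) - ln (pmf p x)) * pmf p x / ln b \<le> (q x - pmf p x) / ln b"
      using b by (intro divide_right_mono) auto
    moreover have "- log b (pmf p x) * pmf p x - - log b (q x) * pmf p x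
        = (ln (q x) - ln (pmf p x)) * pmf p x / ln b"
      by (simp add: log_def left_diff_distrib diff_divide_distrib)
    ultimately show ?thesis by simp
  qed
  then have "(\<Sum>x\<in>?S. - log b (pmf p x) * pmf p x - - log b (q x) * pmf p x)
      \<le> (\<Sum>x\<in>?S. (q x - pmf p x) / ln b)"
    by (rule sum_mono)
  also have "\<dots> = ((\<Sum>x\<in>?S. q x) - 1) / ln b"
    by (simp add: sum_divide_distrib[symmetric] sum_subtractf sum_pmf_eq_1[OF fin])
  also have "\<dots> \<le> 0" using sub b by (simp add: divide_nonpos_pos)
  finally have "(\<Sum>x\<in>?S. - log b (pmf p x) * pmf p x) \<le> (\<Sum>x\<in>?S. - log b (q x) * pmf p x)"
    unfolding sum_subtractf by linarith
  moreover have "measure_pmf.expectation p f = (\<Sum>x\<in>?S. f x * pmf p x)" for f :: "_ \<Rightarrow> real"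
    using fin by (intro integral_measure_pmf_real) auto
  ultimately show ?thesis by (simp only: pmf_entropy_def)
qed

lemma pmf_entropy_map:
  "pmf_entropy b (map_pmf f p) = measure_pmf.expectation p (\<lambda>x. - log b (pmf (map_pmf f p) (f x)))"
  unfolding pmf_entropy_def by simp

lemma pmf_le_pmf_map: "pmf p x \<le> pmf (map_pmf f p) (f x)"
proof -
  have "measure (measure_pmf p) {x} \<le> measure (measure_pmf p) (f -` {f x})"
    by (intro measure_pmf.finite_measure_mono) auto
  then show ?thesis by (simp add: pmf_map measure_pmf_single)
qed

text \<open>Applying a function merges atoms, which can only increase their probabilities.\<close>

lemma pmf_entropy_map_le:
  assumes b: "b > 1" and fin: "finite (set_pmf p)"
  shows "pmf_entropy b (map_pmf f p) \<le> pmf_entropy b p"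
  unfolding pmf_entropy_map pmf_entropy_def[of b p]
proof (intro integral_mono_AE integrable_measure_pmf_finite fin, unfold AE_measure_pmf_iff,
    intro ballI)
  fix x assume "x \<in> set_pmf p"
  then have "log b (pmf p x) \<le> log b (pmf (map_pmf f p) (f x))"
    by (intro log_mono b pmf_positive pmf_le_pmf_map)
  then show "- log b (pmf (map_pmf f p) (f x)) \<le> - log b (pmf p x)" by simp
qed

text \<open>
  A sub-stochastic kernel \<open>K\<close> is a guess at the conditional law of the first coordinate given
  the second, and its expected code length bounds the conditional entropy.
\<close>

lemma pmf_entropy_le_kernel:
  assumes b: "b > 1" and fin: "finite (set_pmf \<pi>)"
    and A: "finite A" "fst ` set_pmf \<pi> \<subseteq> A"
    and pos: "\<And>z. z \<in> set_pmf \<pi> \<Longrightarrow> K (fst z) (snd z) > 0"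
    and nonneg: "\<And>x y. K x y \<ge> 0"
    and sub: "\<And>y. y \<in> snd ` set_pmf \<pi> \<Longrightarrow> (\<Sum>x\<in>A. K x y) \<le> 1"
  shows "pmf_entropy b \<pi> \<le> pmf_entropy b (map_pmf snd \<pi>)
           + measure_pmf.expectation \<pi> (\<lambda>z. - log b (K (fst z) (snd z)))"
proof -
  let ?m = "map_pmf snd \<pi>" and ?B = "snd ` set_pmf \<pi>"
  have mpos: "pmf ?m (snd z) > 0" if "z \<in> set_pmf \<pi>" for z
    using that by (intro pmf_positive) auto
  have "(\<Sum>z\<in>set_pmf \<pi>. pmf ?m (snd z) * K (fst z) (snd z))
      \<le> (\<Sum>z\<in>A \<times> ?B. pmf ?m (snd z) * K (fst z) (snd z))"
  proof (rule sum_mono2)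
    show "set_pmf \<pi> \<subseteq> A \<times> ?B"
      by (rule order_trans[OF subset_fst_snd Sigma_mono[OF A(2)]]) simp
  qed (use A fin nonneg in auto)
  also have "\<dots> = (\<Sum>x\<in>A. \<Sum>y\<in>?B. pmf ?m y * K x y)"
    by (simp add: sum.cartesian_product case_prod_beta)
  also have "\<dots> = (\<Sum>y\<in>?B. \<Sum>x\<in>A. pmf ?m y * K x y)"
    by (rule sum.swap)
  also have "\<dots> = (\<Sum>y\<in>?B. pmf ?m y * (\<Sum>x\<in>A. K x y))"
    by (simp only: sum_distrib_left)
  also have "\<dots> \<le> (\<Sum>y\<in>?B. pmf ?m y * 1)"
    by (intro sum_mono mult_left_mono sub) auto
  also have "\<dots> = 1"
    using fin by (simp add: sum_pmf_eq_1)
  finally have "pmf_entropy b \<pi>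
      \<le> measure_pmf.expectation \<pi> (\<lambda>z. - log b (pmf ?m (snd z) * K (fst z) (snd z)))"
    using mpos pos by (intro pmf_entropy_le_cross_entropy[OF b fin] mult_pos_pos)
  also have "\<dots> = measure_pmf.expectation \<pi>
      (\<lambda>z. - log b (pmf ?m (snd z)) + - log b (K (fst z) (snd z)))"
  proof (rule integral_cong_AE)
    have "- log b (pmf ?m (snd z) * K (fst z) (snd z))
        = - log b (pmf ?m (snd z)) + - log b (K (fst z) (snd z))" if "z \<in> set_pmf \<pi>" for z
      using mpos[OF that] pos[OF that] by (simp add: log_mult)
    then show "AE z in measure_pmf \<pi>. - log b (pmf ?m (snd z) * K (fst z) (snd z))
        = - log b (pmf ?m (snd z)) + - log b (K (fst z) (snd z))"
      unfolding AE_measure_pmf_iff by blast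
  qed simp_all
  also have "\<dots> = pmf_entropy b ?m + measure_pmf.expectation \<pi> (\<lambda>z. - log b (K (fst z) (snd z)))"
    unfolding pmf_entropy_map
    by (intro Bochner_Integration.integral_add integrable_measure_pmf_finite fin)
  finally show ?thesis .
qed

lemma entropy_fst_le_snd_plus_cost:
  assumes "b > 1" "finite (set_pmf \<pi>)" "finite A" "fst ` set_pmf \<pi> \<subseteq> A"
    and "\<And>z. z \<in> set_pmf \<pi> \<Longrightarrow> K (fst z) (snd z) > 0"
    and "\<And>x y. K x y \<ge> 0"
    and "\<And>y. y \<in> snd ` set_pmf \<pi> \<Longrightarrow> (\<Sum>x\<in>A. K x y) \<le> 1"
  shows "pmf_entropy b (map_pmf fst \<pi>) \<le> pmf_entropy b (map_pmf snd \<pi>)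
           + measure_pmf.expectation \<pi> (\<lambda>z. - log b (K (fst z) (snd z)))"
  using pmf_entropy_map_le[OF assms(1,2)] pmf_entropy_le_kernel[of b \<pi> A K, OF assms]
  by (rule order_trans)

text \<open>The kernel that ignores the second coordinate gives subadditivity.\<close>

lemma pmf_entropy_subadditive:
  assumes b: "b > 1" and fin: "finite (set_pmf \<pi>)"
  shows "pmf_entropy b \<pi> \<le> pmf_entropy b (map_pmf snd \<pi>) + pmf_entropy b (map_pmf fst \<pi>)"
  unfolding pmf_entropy_map[of b fst]
proof (rule pmf_entropy_le_kernel[OF b fin, where A = "fst ` set_pmf \<pi>"
      and K = "\<lambda>x y. pmf (map_pmf fst \<pi>) x"])
  show "pmf (map_pmf fst \<pi>) (fst z) > 0" if "z \<in> set_pmf \<pi>" for z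
    using that by (intro pmf_positive) auto
  show "(\<Sum>x\<in>fst ` set_pmf \<pi>. pmf (map_pmf fst \<pi>) x) \<le> 1"
    using fin by (intro eq_refl sum_pmf_eq_1) auto
qed (use fin in auto)

section \<open>Counting words by unmatched letters\<close>

text \<open>
  Matched positions are recorded as sets: increasing enumerations are determined by their
  ranges, and sets of positions are easy to count.
\<close>

definition aligned :: "'a list \<Rightarrow> 'a list \<Rightarrow> nat set \<Rightarrow> nat set \<Rightarrow> bool" where
  "aligned u w I J \<longleftrightarrow>
     map ((!) u) (sorted_list_of_set I) = map ((!) w) (sorted_list_of_set J)"

definition lcs_length :: "nat \<Rightarrow> 'a list \<Rightarrow> 'a list \<Rightarrow> nat" where
  "lcs_length n u w = (GREATEST k. matching n u w k)"

lemma matching_le: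
  assumes "matching n u w k"
  shows "k \<le> n"
proof -
  obtain i where i: "strict_mono_on {1..k} i" "\<forall>s\<in>{1..k}. i s < n"
    using assms unfolding matching_def by blast
  have "card {1..k} \<le> card {..<n}"
    using i strict_mono_on_imp_inj_on[OF i(1)] by (intro card_inj_on_le[of i]) auto
  then show ?thesis by simp
qed

lemma matching_lcs_length: "matching n u w (lcs_length n u w)"
  unfolding lcs_length_def
proof (rule GreatestI_ex_nat)
  show "\<exists>k. matching n u w k" by (rule exI[of _ 0]) (auto simp: matching_def strict_mono_on_def)
qed (rule matching_le)

lemma lcs_length_le: "lcs_length n u w \<le> n"
  by (rule matching_le[OF matching_lcs_length])

lemma lcs_length_commute: "lcs_length n u w = lcs_length n w u"
proof -
  have "matching n u w = matching n w u" unfolding matching_def by (intro ext) metis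
  then show ?thesis by (simp add: lcs_length_def)
qed

lemma fbar_commute: "fbar n u w = fbar n w u"
  using lcs_length_commute[of n u w] by (simp add: fbar_def lcs_length_def)

lemma unmatched_eq_fbar: "real (n - lcs_length n u w) = real n * fbar n u w"
  using lcs_length_le[of n u w] lcs_length_le[of 0 u w]
  by (cases "n = 0") (simp_all add: fbar_def lcs_length_def)

lemma sorted_list_of_set_strict_mono_image:
  fixes i :: "nat \<Rightarrow> nat"
  assumes "strict_mono_on {1..k} i"
  shows "sorted_list_of_set (i ` {1..k}) = map i [1..<Suc k]"
proof (rule strict_sorted_equal)
  show "sorted_wrt (<) (map i [1..<Suc k])"
    using assms by (auto simp: sorted_wrt_iff_nth_less strict_mono_on_def simp del: upt_Suc)
qed (auto simp del: upt_Suc)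

lemma matching_imp_aligned:
  assumes "matching n u w k"
  shows "\<exists>I J. I \<subseteq> {..<n} \<and> J \<subseteq> {..<n} \<and> card I = k \<and> card J = k \<and> aligned u w I J"
proof -
  obtain i j where ij: "strict_mono_on {1..k} i" "strict_mono_on {1..k} j"
    "\<forall>s\<in>{1..k}. i s < n \<and> j s < n \<and> u ! i s = w ! j s"
    using assms unfolding matching_def by blast
  show ?thesis
  proof (intro exI conjI)
    show "aligned u w (i ` {1..k}) (j ` {1..k})"
      unfolding aligned_def sorted_list_of_set_strict_mono_image[OF ij(1)]
        sorted_list_of_set_strict_mono_image[OF ij(2)]
      using ij(3) by (auto simp del: upt_Suc)
  qed (use ij in \<open>auto simp: card_image strict_mono_on_imp_inj_on\<close>)
qed

lemma finite_words [simp]: "finite (words n :: 'a::finite list set)"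
  using finite_lists_length_eq[of "UNIV :: 'a set" n] by (simp add: words_def)

text \<open>
  Once \<open>I\<close> and \<open>J\<close> are known, \<open>w\<close> dictates the letters of \<open>u\<close> on \<open>I\<close>, so that only the letters
  off \<open>I\<close> are free.
\<close>

lemma card_aligned_le:
  fixes w :: "'a::finite list"
  assumes I: "I \<subseteq> {..<n}"
  shows "card {u \<in> words n. aligned u w I J} \<le> CARD('a) ^ (n - card I)"
proof -
  have fI: "finite I" using I by (rule finite_subset) simp
  have "card {u \<in> words n. aligned u w I J} \<le> card (({..<n} - I) \<rightarrow>\<^sub>E (UNIV :: 'a set))"
  proof (rule card_inj_on_le)
    show "inj_on (\<lambda>u. restrict ((!) u) ({..<n} - I)) {u \<in> words n. aligned u w I J}"
    proof (rule inj_onI)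
      fix u v assume u: "u \<in> {u \<in> words n. aligned u w I J}"
        and v: "v \<in> {u \<in> words n. aligned u w I J}"
        and eq: "restrict ((!) u) ({..<n} - I) = restrict ((!) v) ({..<n} - I)"
      have "map ((!) u) (sorted_list_of_set I) = map ((!) v) (sorted_list_of_set I)"
        using u v by (simp add: aligned_def)
      then have on: "u ! x = v ! x" if "x \<in> I" for x
        using that fI by simp
      have off: "u ! x = v ! x" if "x < n" "x \<notin> I" for x
        using fun_cong[OF eq, of x] that by (simp add: restrict_def)
      show "u = v"
        using u v on off by (intro nth_equalityI) (auto simp: words_def)
    qed
    show "(\<lambda>u. restrict ((!) u) ({..<n} - I)) ` {u \<in> words n. aligned u w I J}
        \<subseteq> ({..<n} - I) \<rightarrow>\<^sub>E UNIV"
      by (intro image_subsetI restrict_PiE_iff[THEN iffD2]) auto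
  qed (intro finite_PiE, auto)
  also have "\<dots> = CARD('a) ^ (n - card I)"
    using I fI by (simp add: card_funcsetE card_Diff_subset)
  finally show ?thesis .
qed

text \<open>
  The mass of the words whose best matching with \<open>w\<close> uses the positions \<open>I\<close> and \<open>J\<close> is at most
  \<open>s ^ (2 * (n - card I))\<close>, the factor \<open>1 / N\<close> per unmatched letter paying for the choice of that
  letter. As \<open>card I = card J\<close>, this factorises over \<open>I\<close> and \<open>J\<close>, and the binomial theorem
  sums each factor to \<open>(1 + s) ^ n\<close>.
\<close>

lemma sum_unmatched_le:
  fixes w :: "'a::finite list" and s :: real
  assumes s: "s > 0"
  shows "(\<Sum>u\<in>words n. (s\<^sup>2 / real CARD('a)) ^ (n - lcs_length n u w)) \<le> (1 + s) ^ (2 * n)"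
proof -
  let ?\<theta> = "s\<^sup>2 / real CARD('a)" and ?P = "Pow {..<n} \<times> Pow {..<n}"
  let ?T = "{(I, J) \<in> ?P. card I = card J}"
  let ?al = "\<lambda>u (I, J). aligned u w I J"
  have N: "real CARD('a) > 0" by simp
  have \<theta>: "?\<theta> > 0" using s N by simp
  have finT: "finite ?T" by (rule finite_subset[of _ ?P]) auto
  have "(\<Sum>u\<in>words n. ?\<theta> ^ (n - lcs_length n u w))
      \<le> (\<Sum>u\<in>words n. \<Sum>z\<in>?T. if ?al u z then ?\<theta> ^ (n - card (fst z)) else 0)"
  proof (rule sum_mono)
    fix u :: "'a list"
    obtain I J where IJ: "I \<subseteq> {..<n}" "J \<subseteq> {..<n}" "card I = lcs_length n u w"
      "card J = lcs_length n u w" "aligned u w I J"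
      using matching_imp_aligned[OF matching_lcs_length[of n u w]] by blast
    have "?\<theta> ^ (n - lcs_length n u w)
        = (\<Sum>z\<in>{(I, J)}. if ?al u z then ?\<theta> ^ (n - card (fst z)) else 0)"
      using IJ by simp
    also have "\<dots> \<le> (\<Sum>z\<in>?T. if ?al u z then ?\<theta> ^ (n - card (fst z)) else 0)"
      using IJ \<theta> finT by (intro sum_mono2) auto
    finally show "?\<theta> ^ (n - lcs_length n u w)
      \<le> (\<Sum>z\<in>?T. if ?al u z then ?\<theta> ^ (n - card (fst z)) else 0)" .
  qed
  also have "\<dots> = (\<Sum>z\<in>?T. real (card {u \<in> words n. ?al u z}) * ?\<theta> ^ (n - card (fst z)))"
    by (subst sum.swap) (simp add: sum.If_cases Int_def)
  also have "\<dots> \<le> (\<Sum>z\<in>?T. s ^ (n - card (fst z)) * s ^ (n - card (snd z)))"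
  proof (rule sum_mono)
    fix z assume "z \<in> ?T"
    then obtain I J where z: "z = (I, J)" "I \<subseteq> {..<n}" "card J = card I" by auto
    let ?d = "n - card I"
    have "real (card {u \<in> words n. aligned u w I J}) * ?\<theta> ^ ?d \<le> real (CARD('a) ^ ?d) * ?\<theta> ^ ?d"
      using card_aligned_le[OF z(2), of w J] \<theta> by (intro mult_right_mono) (auto simp del: of_nat_power)
    also have "\<dots> = (real CARD('a) * ?\<theta>) ^ ?d" by (simp only: of_nat_power power_mult_distrib)
    also have "\<dots> = s ^ ?d * s ^ ?d"
      using N by (simp add: power2_eq_square power_mult_distrib)
    finally show "real (card {u \<in> words n. ?al u z}) * ?\<theta> ^ (n - card (fst z))
        \<le> s ^ (n - card (fst z)) * s ^ (n - card (snd z))"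
      using z by simp
  qed
  also have "\<dots> \<le> (\<Sum>z\<in>?P. s ^ (n - card (fst z)) * s ^ (n - card (snd z)))"
    using s by (intro sum_mono2) auto
  also have "\<dots> = (\<Sum>I\<in>Pow {..<n}. s ^ (n - card I)) * (\<Sum>J\<in>Pow {..<n}. s ^ (n - card J))"
    by (simp add: sum_product sum.cartesian_product case_prod_beta)
  also have "(\<Sum>I\<in>Pow {..<n}. s ^ (n - card I)) = (\<Prod>x\<in>{..<n}. 1 + s)"
    unfolding prod_add[OF finite_lessThan]
    by (intro sum.cong) (auto simp: card_Diff_subset finite_subset)
  also have "(\<Prod>x\<in>{..<n}. 1 + s) * (\<Prod>x\<in>{..<n}. 1 + s) = (1 + s) ^ (2 * n)"
    by (simp add: power_add[symmetric] mult_2)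
  finally show ?thesis .
qed

text \<open>
  The conditional code length of \<open>u\<close> given \<open>w\<close> under the kernel built from \<open>sum_unmatched_le\<close> is
  affine in \<open>fbar n u w\<close>, so its mean only involves the mean cost of the coupling. The absolute
  value covers large \<open>s\<close>, where the decay rate \<open>s\<^sup>2 / N\<close> exceeds \<open>1\<close>.
\<close>

lemma entropy_le_of_coupling:
  fixes \<pi> :: "('a::finite list \<times> 'a list) pmf"
  assumes b: "b > 1" and s: "s > 0" and supp: "set_pmf \<pi> \<subseteq> words n \<times> words n"
  shows "pmf_entropy b (map_pmf fst \<pi>) \<le> pmf_entropy b (map_pmf snd \<pi>)
           + real n * (2 * log b (1 + s) + \<bar>log b (s\<^sup>2 / real CARD('a))\<bar>
                * measure_pmf.expectation \<pi> (\<lambda>z. fbar n (fst z) (snd z)))"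
proof -
  let ?\<theta> = "s\<^sup>2 / real CARD('a)"
  let ?K = "\<lambda>u w :: 'a list. ?\<theta> ^ (n - lcs_length n u w) / (1 + s) ^ (2 * n)"
  have \<theta>: "?\<theta> > 0" using s by simp
  have fin: "finite (set_pmf \<pi>)"
    by (rule finite_subset[OF supp]) simp
  have int: "integrable (measure_pmf \<pi>) f" for f :: "_ \<Rightarrow> real"
    by (rule integrable_measure_pmf_finite[OF fin])
  have cost: "- log b (?K u w) \<le> real n * (2 * log b (1 + s)) + real n * \<bar>log b ?\<theta>\<bar> * fbar n u w"
    for u w
  proof -
    have "- log b (?K u w) = real (2 * n) * log b (1 + s) - real (n - lcs_length n u w) * log b ?\<theta>"
      using b s \<theta> by (subst log_divide) (auto simp del: of_nat_mult simp: log_nat_power)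
    also have "\<dots> \<le> real (2 * n) * log b (1 + s) + real (n - lcs_length n u w) * \<bar>log b ?\<theta>\<bar>"
      using mult_left_mono[of "- log b ?\<theta>" "\<bar>log b ?\<theta>\<bar>" "real (n - lcs_length n u w)"] by simp
    finally show ?thesis by (simp add: unmatched_eq_fbar mult_ac)
  qed
  have "pmf_entropy b (map_pmf fst \<pi>) \<le> pmf_entropy b (map_pmf snd \<pi>)
      + measure_pmf.expectation \<pi> (\<lambda>z. - log b (?K (fst z) (snd z)))"
  proof (rule entropy_fst_le_snd_plus_cost[OF b fin finite_words[of n]])
    show "(\<Sum>u\<in>words n. ?K u w) \<le> 1" for w
      using sum_unmatched_le[OF s, of n w] s by (simp add: sum_divide_distrib[symmetric])
  qed (use supp \<theta> s in auto)
  also have "measure_pmf.expectation \<pi> (\<lambda>z. - log b (?K (fst z) (snd z)))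
      \<le> measure_pmf.expectation \<pi> (\<lambda>z. real n * (2 * log b (1 + s))
            + real n * \<bar>log b ?\<theta>\<bar> * fbar n (fst z) (snd z))"
    by (intro integral_mono int cost)
  also have "\<dots> = real n * (2 * log b (1 + s) + \<bar>log b ?\<theta>\<bar>
                * measure_pmf.expectation \<pi> (\<lambda>z. fbar n (fst z) (snd z)))"
    by (subst Bochner_Integration.integral_add[OF int int]) (simp add: algebra_simps)
  finally show ?thesis by simp
qed

section \<open>Existence of the entropy rate\<close>

lemma subadditive_mult_add:
  fixes a :: "nat \<Rightarrow> real"
  assumes "\<And>m n. a (m + n) \<le> a m + a n"
  shows "a (q * m + r) \<le> real q * a m + a r"
proof (induction q)
  case (Suc q)
  have "a (Suc q * m + r) \<le> a m + a (q * m + r)"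
    using assms[of m "q * m + r"] by (simp add: add_ac)
  with Suc show ?case by (simp add: algebra_simps)
qed simp

text \<open>
  Fekete's lemma for nonnegative sequences. The limit is the infimum of \<open>a n / n\<close>: if \<open>m\<close> nearly
  attains it, cutting \<open>n\<close> into pieces of length \<open>m\<close> and a remainder below \<open>m\<close> gives
  \<open>a n / n \<le> a m / m + C / n\<close>.
\<close>

lemma convergent_of_subadditive:
  fixes a :: "nat \<Rightarrow> real"
  assumes sub: "\<And>m n. a (m + n) \<le> a m + a n" and nonneg: "\<And>n. a n \<ge> 0"
  shows "convergent (\<lambda>n. a n / real n)"
proof -
  define L where "L = (INF n\<in>{1..}. a n / real n)"
  have bdd: "bdd_below ((\<lambda>n. a n / real n) ` {1..})"
    using nonneg by (intro bdd_belowI[of _ 0]) auto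
  have "(\<lambda>n. a n / real n) \<longlonglongrightarrow> L"
  proof (rule LIMSEQ_I)
    fix e :: real assume e: "e > 0"
    have "\<exists>m\<in>{1..}. a m / real m < L + e / 2"
      using cInf_lessD[of "(\<lambda>n. a n / real n) ` {1..}" "L + e / 2"] e by (auto simp: L_def)
    then obtain m where m: "m \<ge> 1" "a m / real m < L + e / 2" by auto
    define C where "C = Max (a ` {..<m})"
    have C: "a r \<le> C" if "r < m" for r
      unfolding C_def using that by (intro Max_ge) auto
    have upper: "a n / real n \<le> a m / real m + C / real n" if n: "n \<ge> 1" for n
    proof -
      have "a n \<le> real (n div m) * a m + a (n mod m)"
        using subadditive_mult_add[of a "n div m" m "n mod m"] sub by simp
      also have "\<dots> \<le> real n / real m * a m + C"
        using m nonneg[of m] C[of "n mod m"] of_nat_div_le_of_nat[of n m, where ?'a = real]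
        by (intro add_mono mult_right_mono) auto
      finally show ?thesis using n by (simp add: field_simps)
    qed
    obtain n0 where n0: "2 * C / e < real n0" using reals_Archimedean2 by blast
    show "\<exists>n0. \<forall>n\<ge>n0. norm (a n / real n - L) < e"
    proof (intro exI allI impI)
      fix n assume n: "n \<ge> Suc n0"
      have "L \<le> a n / real n"
        unfolding L_def using n by (intro cINF_lower bdd) auto
      moreover have "C / real n < e / 2"
      proof -
        have "2 * C / e < real n" using n0 n by linarith
        then show ?thesis using e n by (simp add: field_simps)
      qed
      ultimately show "norm (a n / real n - L) < e"
        using upper[of n] m(2) n unfolding real_norm_def by linarith
    qed
  qed
  then show ?thesis by (rule convergentI)
qed

lemma measure_pmf_exists:
  fixes M :: "'c::countable measure"
  assumes "prob_space M" "sets M = UNIV"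
  shows "\<exists>p. measure_pmf p = M"
proof -
  interpret prob_space M by fact
  have "AE x in M. measure M {x} \<noteq> 0"
    using AE_support_countable[OF assms(2)] by (auto intro!: exI[of _ UNIV])
  then show ?thesis
    using assms by (intro exI[of _ "Abs_pmf M"]) (simp add: Abs_pmf_inverse)
qed

text \<open>
  As a \<open>pmf\<close>, a block distribution can be compared with the marginals of a coupling by equations
  between discrete distributions.
\<close>

definition block_pmf :: "(nat \<Rightarrow> 'a::finite) measure \<Rightarrow> nat \<Rightarrow> 'a list pmf" where
  "block_pmf \<nu> n = (SOME p. measure_pmf p = block_dist \<nu> n)"

context
  fixes \<nu> :: "(nat \<Rightarrow> 'a::finite) measure"
  assumes st: "stationary \<nu>"
begin

lemma prob_space_\<nu>: "prob_space \<nu>"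
  using st by (simp add: stationary_def)

lemma sets_\<nu>: "sets \<nu> = sets (seq_space :: (nat \<Rightarrow> 'a) measure)"
  using st by (simp add: stationary_def)

lemma measurable_\<nu>_block: "(\<lambda>z. map z [0..<n]) \<in> measurable \<nu> (count_space UNIV)"
  using measurable_block by (simp only: measurable_cong_sets[OF sets_\<nu> refl])

lemma measure_block_pmf: "measure_pmf (block_pmf \<nu> n) = block_dist \<nu> n"
  unfolding block_pmf_def
proof (rule someI_ex[OF measure_pmf_exists])
  show "prob_space (block_dist \<nu> n)"
    unfolding block_dist_def
    by (rule prob_space.prob_space_distr[OF prob_space_\<nu> measurable_\<nu>_block])
qed (simp add: block_dist_def)

lemma set_block_pmf: "set_pmf (block_pmf \<nu> n) \<subseteq> words n"
proof -
  have "AE u in measure_pmf (block_pmf \<nu> n). u \<in> words n"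
    unfolding measure_block_pmf block_dist_def
    by (subst AE_distr_iff[OF measurable_\<nu>_block]) (auto simp: words_def)
  then show ?thesis by (auto simp: AE_measure_pmf_iff)
qed

lemma entropy_block_pmf:
  "(\<Sum>u\<in>words n. \<eta> b (measure (block_dist \<nu> n) {u})) = pmf_entropy b (block_pmf \<nu> n)"
proof -
  have "measure (block_dist \<nu> n) {u} = pmf (block_pmf \<nu> n) u" for u
    by (simp only: measure_block_pmf[symmetric] measure_pmf_single)
  then show ?thesis
    by (simp only: pmf_entropy_eq_sum[OF finite_words set_block_pmf])
qed

lemma measurable_shift: "shift \<in> measurable \<nu> seq_space"
proof -
  have "(\<lambda>z i. z (Suc i)) \<in> measurable (PiM UNIV (\<lambda>_. count_space UNIV))
      (PiM UNIV (\<lambda>_. count_space (UNIV :: 'a set)))"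
  proof (rule measurable_PiM_single'[where f = "\<lambda>i z. z (Suc i)"])
    show "(\<lambda>z. z (Suc i)) \<in> measurable (PiM UNIV (\<lambda>_. count_space UNIV))
        (count_space (UNIV :: 'a set))" for i
      by (rule measurable_component_singleton) simp
  qed (simp add: PiE_def)
  moreover have "shift = (\<lambda>(z :: nat \<Rightarrow> 'a) i. z (Suc i))"
    by (intro ext) (simp add: shift_def)
  ultimately have "shift \<in> measurable seq_space (seq_space :: (nat \<Rightarrow> 'a) measure)"
    by (simp only: seq_space_def)
  then show ?thesis
    by (simp only: measurable_cong_sets[OF sets_\<nu> refl])
qed

lemma measurable_shift_funpow: "(shift ^^ m) \<in> measurable \<nu> \<nu>"
proof -
  have shift: "shift \<in> measurable \<nu> \<nu>"
    using measurable_shift by (simp only: measurable_cong_sets[OF refl sets_\<nu>])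
  show ?thesis
  proof (induction m)
    case (Suc m)
    show ?case
      unfolding funpow.simps by (rule measurable_comp[OF Suc shift])
  qed (simp add: id_def)
qed

lemma distr_shift_funpow: "distr \<nu> \<nu> (shift ^^ m) = \<nu>"
proof (induction m)
  case 0
  then show ?case by (simp add: id_def distr_id2)
next
  case (Suc m)
  have sh: "shift \<in> measurable \<nu> \<nu>" using measurable_shift_funpow[of 1] by simp
  have "distr \<nu> \<nu> shift = distr \<nu> seq_space shift"
    using st by (intro distr_cong) (auto simp: stationary_def)
  then have one: "distr \<nu> \<nu> shift = \<nu>"
    using st by (simp add: stationary_def)
  have "distr \<nu> \<nu> (shift ^^ Suc m) = distr (distr \<nu> \<nu> (shift ^^ m)) \<nu> shift"
    by (simp add: distr_distr[OF sh measurable_shift_funpow])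
  then show ?case by (simp only: Suc one)
qed

lemma shift_funpow: "(shift ^^ m) z i = z (m + i)"
  by (induction m arbitrary: i) (auto simp: shift_def)

lemma block_shift_funpow: "map ((shift ^^ m) z) [0..<n] = map z [m..<m + n]"
  by (rule nth_equalityI) (auto simp: shift_funpow)

text \<open>
  Splitting a block of length \<open>m + n\<close> after \<open>m\<close> letters loses no entropy, and by stationarity
  the second part is distributed as an initial block.
\<close>

lemma block_entropy_subadditive:
  assumes b: "b > 1"
  shows "pmf_entropy b (block_pmf \<nu> (m + n)) \<le> pmf_entropy b (block_pmf \<nu> m) + pmf_entropy b (block_pmf \<nu> n)"
proof -
  let ?p = "block_pmf \<nu> (m + n)" and ?split = "\<lambda>u :: 'a list. (take m u, drop m u)"
  let ?\<pi> = "map_pmf ?split ?p"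
  have fin: "finite (set_pmf ?p)"
    by (rule finite_subset[OF set_block_pmf]) simp
  have block: "distr (block_dist \<nu> (m + n)) (count_space UNIV) f
      = distr \<nu> (count_space UNIV) (\<lambda>z. f (map z [0..<m + n]))" for f :: "'a list \<Rightarrow> 'a list"
    unfolding block_dist_def by (subst distr_distr[OF _ measurable_\<nu>_block]) (auto simp: comp_def)
  have fst: "map_pmf fst ?\<pi> = block_pmf \<nu> m"
  proof (rule measure_pmf_inject[THEN iffD1])
    show "measure_pmf (map_pmf fst ?\<pi>) = measure_pmf (block_pmf \<nu> m)"
      by (simp add: map_pmf_comp map_pmf_rep_eq measure_block_pmf block)
         (simp add: block_dist_def take_map)
  qed
  have "distr \<nu> (count_space UNIV) (\<lambda>z. map z [m..<m + n])
      = distr (distr \<nu> \<nu> (shift ^^ m)) (count_space UNIV) (\<lambda>z. map z [0..<n])"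
    by (subst distr_distr[OF measurable_\<nu>_block measurable_shift_funpow])
       (simp add: comp_def block_shift_funpow)
  then have snd: "map_pmf snd ?\<pi> = block_pmf \<nu> n"
    by (intro measure_pmf_inject[THEN iffD1])
       (simp add: map_pmf_comp map_pmf_rep_eq measure_block_pmf block drop_map
          distr_shift_funpow block_dist_def[of \<nu> n])
  have "pmf_entropy b ?p = pmf_entropy b (map_pmf (\<lambda>(u, v). u @ v) ?\<pi>)"
    by (simp add: map_pmf_comp)
  also have "\<dots> \<le> pmf_entropy b ?\<pi>"
    using fin by (intro pmf_entropy_map_le b) simp
  also have "\<dots> \<le> pmf_entropy b (map_pmf snd ?\<pi>) + pmf_entropy b (map_pmf fst ?\<pi>)"
    using fin by (intro pmf_entropy_subadditive b) simp
  finally show ?thesis unfolding fst snd by simp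
qed

lemma entropy_rate_LIMSEQ:
  assumes b: "b > 1"
  shows "(\<lambda>n. pmf_entropy b (block_pmf \<nu> n) / real n) \<longlonglongrightarrow> entropy_rate b \<nu>"
proof -
  have "convergent (\<lambda>n. pmf_entropy b (block_pmf \<nu> n) / real n)"
    by (intro convergent_of_subadditive block_entropy_subadditive pmf_entropy_nonneg b)
  then show ?thesis
    by (simp add: entropy_rate_def entropy_block_pmf convergent_LIMSEQ_iff)
qed

end

section \<open>Continuity of the entropy rate\<close>

lemma set_coupling_subset:
  assumes "stationary \<nu>" "stationary \<nu>'" "map_pmf fst \<pi> = block_pmf \<nu> n"
    "map_pmf snd \<pi> = block_pmf \<nu>' n"
  shows "set_pmf \<pi> \<subseteq> words n \<times> words n"
proof -
  have "fst ` set_pmf \<pi> \<subseteq> words n" "snd ` set_pmf \<pi> \<subseteq> words n"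
    using set_block_pmf[OF assms(1), of n] set_block_pmf[OF assms(2), of n]
    by (simp_all only: assms(3,4)[symmetric] set_map_pmf)
  then show ?thesis
    by (rule order_trans[OF subset_fst_snd Sigma_mono])
qed

lemma FK_dist_less_imp_coupling:
  fixes \<nu> \<nu>' :: "(nat \<Rightarrow> 'a::finite) measure"
  assumes st: "stationary \<nu>" "stationary \<nu>'" and less: "FK_dist \<nu> \<nu>' < ereal \<delta>"
  shows "\<forall>\<^sub>F n in sequentially. \<exists>\<pi>. map_pmf fst \<pi> = block_pmf \<nu> n \<and> map_pmf snd \<pi> = block_pmf \<nu>' n
           \<and> measure_pmf.expectation \<pi> (\<lambda>z. fbar n (fst z) (snd z)) < \<delta>"
proof -
  let ?c = "\<lambda>n \<pi>. \<Sum>(u, w)\<in>words n \<times> words n. fbar n u w * pmf \<pi> (u, w)"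
  have iff: "\<pi> \<in> couplings \<nu> \<nu>' n \<longleftrightarrow> map_pmf fst \<pi> = block_pmf \<nu> n \<and> map_pmf snd \<pi> = block_pmf \<nu>' n"
    for \<pi> n
    by (simp only: couplings_def mem_Collect_eq measure_block_pmf[OF st(1), symmetric]
        measure_block_pmf[OF st(2), symmetric] measure_pmf_inject)
  have "\<forall>\<^sub>F n in sequentially. (INF \<pi>\<in>couplings \<nu> \<nu>' n. ?c n \<pi>) < \<delta>"
    using Limsup_lessD[OF less[unfolded FK_dist_def]] by simp
  then show ?thesis
  proof (rule eventually_mono)
    fix n assume inf: "(INF \<pi>\<in>couplings \<nu> \<nu>' n. ?c n \<pi>) < \<delta>"
    \<comment> \<open>The product coupling keeps the infimum from ranging over the empty set, where it
      would carry no information.\<close>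
    have "pair_pmf (block_pmf \<nu> n) (block_pmf \<nu>' n) \<in> couplings \<nu> \<nu>' n"
      by (simp add: iff map_fst_pair_pmf map_snd_pair_pmf)
    then have "couplings \<nu> \<nu>' n \<noteq> {}" by blast
    then obtain \<pi> where \<pi>: "\<pi> \<in> couplings \<nu> \<nu>' n" "?c n \<pi> < \<delta>"
      using cInf_lessD[OF _ inf] by auto
    have "set_pmf \<pi> \<subseteq> words n \<times> words n"
      using \<pi>(1) by (intro set_coupling_subset[OF st]) (auto simp: iff)
    then have "measure_pmf.expectation \<pi> (\<lambda>z. fbar n (fst z) (snd z))
        = (\<Sum>z\<in>words n \<times> words n. fbar n (fst z) (snd z) * pmf \<pi> z)"
      by (intro integral_measure_pmf_real) auto
    with \<pi> show "\<exists>\<pi>. map_pmf fst \<pi> = block_pmf \<nu> n \<and> map_pmf snd \<pi> = block_pmf \<nu>' n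
           \<and> measure_pmf.expectation \<pi> (\<lambda>z. fbar n (fst z) (snd z)) < \<delta>"
      by (auto simp: iff case_prod_beta)
  qed
qed

theorem theorem1p4:
  fixes b \<epsilon> :: real
  assumes "b > 1" and "\<epsilon> > 0"
  shows "\<exists>\<delta>>0::real. \<forall>\<nu> \<nu>' :: (nat \<Rightarrow> 'a::finite) measure.
           ergodic \<nu> \<and> ergodic \<nu>' \<and> FK_dist \<nu> \<nu>' < ereal \<delta>
             \<longrightarrow> \<bar>entropy_rate b \<nu> - entropy_rate b \<nu>'\<bar> < \<epsilon>"
proof -
  \<comment> \<open>Makes \<open>2 * log b (1 + s)\<close> exactly \<open>\<epsilon> / 3\<close>.\<close>
  define s where "s = b powr (\<epsilon> / 6) - 1"
  define c where "c = \<bar>log b (s\<^sup>2 / real CARD('a))\<bar>"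
  \<comment> \<open>The summand \<open>1\<close> guards against \<open>c = 0\<close>.\<close>
  define \<delta> where "\<delta> = \<epsilon> / (3 * (c + 1))"
  have s: "s > 0" and logs: "2 * log b (1 + s) = \<epsilon> / 3"
    using assms by (simp_all add: s_def)
  have c: "c \<ge> 0" by (simp add: c_def)
  have \<delta>: "\<delta> > 0" using assms c by (simp add: \<delta>_def)
  have c\<delta>: "c * \<delta> \<le> \<epsilon> / 3" using assms c by (simp add: \<delta>_def field_simps)
  have bound: "pmf_entropy b (map_pmf fst \<pi>) / real n
      \<le> pmf_entropy b (map_pmf snd \<pi>) / real n + 2 * \<epsilon> / 3"
    if supp: "set_pmf \<pi> \<subseteq> words n \<times> words n" and n: "n \<ge> 1"
      and cost: "measure_pmf.expectation \<pi> (\<lambda>z. fbar n (fst z) (snd z)) < \<delta>"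
    for \<pi> :: "('a list \<times> 'a list) pmf" and n
  proof -
    have "c * measure_pmf.expectation \<pi> (\<lambda>z. fbar n (fst z) (snd z)) \<le> \<epsilon> / 3"
      using mult_left_mono[OF less_imp_le[OF cost] c] c\<delta> by linarith
    then have "real n * (2 * log b (1 + s)
        + c * measure_pmf.expectation \<pi> (\<lambda>z. fbar n (fst z) (snd z))) \<le> real n * (2 * \<epsilon> / 3)"
      unfolding logs by (intro mult_left_mono) auto
    with entropy_le_of_coupling[OF assms(1) s supp]
    have "pmf_entropy b (map_pmf fst \<pi>) \<le> pmf_entropy b (map_pmf snd \<pi>) + real n * (2 * \<epsilon> / 3)"
      unfolding c_def by linarith
    then show ?thesis using n by (simp add: field_simps)
  qed
  show ?thesis
  proof (intro exI[of _ \<delta>] conjI allI impI \<delta>)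
    fix \<nu> \<nu>' :: "(nat \<Rightarrow> 'a) measure"
    assume A: "ergodic \<nu> \<and> ergodic \<nu>' \<and> FK_dist \<nu> \<nu>' < ereal \<delta>"
    then have st: "stationary \<nu>" "stationary \<nu>'" by (auto simp: ergodic_def)
    let ?h = "\<lambda>\<mu> n. pmf_entropy b (block_pmf \<mu> n) / real n"
    have "\<forall>\<^sub>F n in sequentially. \<bar>?h \<nu> n - ?h \<nu>' n\<bar> \<le> 2 * \<epsilon> / 3"
      using FK_dist_less_imp_coupling[OF st conjunct2[OF conjunct2[OF A]]] eventually_ge_at_top[of 1]
    proof eventually_elim
      case (elim n)
      then obtain \<pi> where \<pi>: "map_pmf fst \<pi> = block_pmf \<nu> n" "map_pmf snd \<pi> = block_pmf \<nu>' n"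
        "measure_pmf.expectation \<pi> (\<lambda>z. fbar n (fst z) (snd z)) < \<delta>" and n: "n \<ge> 1"
        by blast
      have supp: "set_pmf \<pi> \<subseteq> words n \<times> words n"
        by (rule set_coupling_subset[OF st \<pi>(1,2)])
      let ?\<pi>' = "map_pmf prod.swap \<pi>"
      have "?h \<nu> n \<le> ?h \<nu>' n + 2 * \<epsilon> / 3"
        using bound[OF supp n \<pi>(3)] by (simp add: \<pi>)
      moreover have "?h \<nu>' n \<le> ?h \<nu> n + 2 * \<epsilon> / 3"
      proof -
        have "set_pmf ?\<pi>' \<subseteq> words n \<times> words n" using supp by auto
        moreover have "measure_pmf.expectation ?\<pi>' (\<lambda>z. fbar n (fst z) (snd z)) < \<delta>"
          using \<pi>(3) by (simp add: fbar_commute[of n "snd _"])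
        ultimately show ?thesis
          using bound[of ?\<pi>' n] n by (simp add: map_pmf_comp \<pi>)
      qed
      ultimately show ?case by linarith
    qed
    then have "\<bar>entropy_rate b \<nu> - entropy_rate b \<nu>'\<bar> \<le> 2 * \<epsilon> / 3"
      by (intro tendsto_upperbound[OF tendsto_rabs[OF tendsto_diff[OF
            entropy_rate_LIMSEQ[OF st(1) assms(1)] entropy_rate_LIMSEQ[OF st(2) assms(1)]]]]) auto
    then show "\<bar>entropy_rate b \<nu> - entropy_rate b \<nu>'\<bar> < \<epsilon>"
      using assms(2) by linarith
  qed
qed

end
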